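(* Let $T_n(x)=\sum_{k=0}^{n-1}|c_n(k)|x^k$. Then: (i) $T_n(-1)=\varphi(n)$ for every odd $n\ge 1$; (ii) $T_n(-1)=0$ for every $n=4k+2$, $k\ge 0$; (iii) $T_n(-1)=\varphi(n)2^{\omega(n)}$ for every $n=4k$, $k\ge 1$; (iv) $T_n(\eta)=n\prod_{p\mid n}\big(1-\frac{2}{p}\big)$ for every primitive $n$th root of unity $\eta$; moreover, the cyclotomic polynomial $\Phi_n(x)$ divides $T_n(x)$ for every even $n\ge 2$.
   Context: For integers $n\ge 1$ and $k$, the Ramanujan sum $c_n(k)$ is the sum of the $k$th powers of the primitive $n$th roots of unity, i.e. $c_n(k)=\sum_{1\le j\le n,\ \gcd(j,n)=1} e^{2\pi \sqrt{-1}\, jk/n}$. $\varphi$ is Euler's function, $\omega(n)$ the number of distinct prime factors of $n$, and $\Phi_n(x)$ the $n$th cyclotomic polynomial. Products over $p$ are over primes. *)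

theory Defs
  imports
    "HOL-Analysis.Analysis"
    "HOL-Computational_Algebra.Computational_Algebra"
    "HOL-Number_Theory.Totient"
begin

definition ramanujan_sum :: "nat \<Rightarrow> int \<Rightarrow> complex" where
  "ramanujan_sum n k =
     (\<Sum>j\<in>{j\<in>{1..n}. gcd j n = 1}.
        exp (2 * of_real pi * \<i> * of_nat j * of_int k / of_nat n))"

definition abs_ramanujan_poly :: "nat \<Rightarrow> complex poly" where
  "abs_ramanujan_poly n =
     (\<Sum>k<n. Polynomial.monom (of_real (cmod (ramanujan_sum n (int k)))) k)"

definition primitive_root_of_unity :: "nat \<Rightarrow> complex \<Rightarrow> bool" where
  "primitive_root_of_unity n z \<longleftrightarrow>
     n > 0 \<and> z ^ n = 1 \<and> (\<forall>m. 0 < m \<and> m < n \<longrightarrow> z ^ m \<noteq> 1)"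

definition cyclotomic_poly :: "nat \<Rightarrow> complex poly" where
  "cyclotomic_poly n = (\<Prod>z | primitive_root_of_unity n z. [:- z, 1:])"

definition num_prime_factors :: "nat \<Rightarrow> nat" where
  "num_prime_factors n = card (prime_factors n)"

text \<open>Divisibility in \<open>\<int>[x]\<close> of complex polynomials that are required to have integer
  coefficients.\<close>

definition int_poly_dvd :: "complex poly \<Rightarrow> complex poly \<Rightarrow> bool" where
  "int_poly_dvd F P \<longleftrightarrow>
     (\<exists>f p :: int poly. F = map_poly of_int f \<and> P = map_poly of_int p \<and> f dvd p)"

end

theory Submission
  imports
    Defs
    "HOL-Library.Real_Mod"
begin

text \<open>
  The Ramanujan sum satisfies \<open>c\<^sub>m\<^sub>n(in + jm) = c\<^sub>m(i) c\<^sub>n(j)\<close> for coprime \<open>m\<close> and \<open>n\<close>. As \<open>in + jm\<close>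
  runs through the residues modulo \<open>mn\<close>, this gives \<open>T\<^sub>m\<^sub>n(z) = T\<^sub>m(z\<^sup>n) T\<^sub>n(z\<^sup>m)\<close> whenever \<open>z\<close> is an
  \<open>mn\<close>th root of unity. Computing \<open>T\<^sub>n\<close> for prime powers \<open>n\<close> then shows, for every \<open>n\<close>th root of
  unity \<open>z\<close>, that \<open>T\<^sub>n(z)\<close> is \<open>n\<close> times the product over the primes \<open>p\<close> dividing \<open>n\<close> of
  \<open>2(1 - 1/p)\<close> if \<open>z\<close> is even an \<open>n/p\<close>th root of unity, and of \<open>1 - 2/p\<close> otherwise. This covers
  all primitive \<open>z\<close>, and \<open>z = -1\<close> for even \<open>n\<close>. For odd \<open>n\<close>, where \<open>-1\<close> is not an \<open>n\<close>th root of
  unity, the terms \<open>k\<close> and \<open>n - k\<close> of \<open>T\<^sub>n(-1)\<close> cancel. If \<open>n\<close> is even, the factor at \<open>p = 2\<close>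
  makes \<open>T\<^sub>n\<close> vanish at all roots of \<open>\<Phi>\<^sub>n\<close>; the quotient is integral because \<open>\<Phi>\<^sub>n\<close> is monic.
\<close>

subsection \<open>Residues and coprime factorizations\<close>

lemma prime_power_cofactorE:
  fixes n :: nat
  assumes "prime p" "p dvd n" "n > 0"
  obtains a m where "n = p ^ Suc a * m" "m > 0" "coprime (p ^ Suc a) m"
proof -
  obtain m where m: "n = p ^ multiplicity p n * m" "\<not> p dvd m"
    using multiplicity_decompose'[of n p] assms not_prime_unit by blast
  have "multiplicity p n > 0"
    using assms by (simp add: prime_multiplicity_gt_zero_iff)
  then obtain a where "multiplicity p n = Suc a"
    using gr0_implies_Suc by blast
  moreover have "coprime (p ^ Suc a) m"
    using assms(1) m(2) by (simp add: prime_imp_coprime del: power_Suc)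
  moreover have "m > 0"
    using m(2) by (auto intro: Nat.gr0I)
  ultimately show thesis
    using that m(1) by metis
qed

lemma coprime_factor_induct [consumes 1, case_names one prime_power mult]:
  fixes n :: nat
  assumes "n > 0"
    and one: "P 1"
    and prime_power: "\<And>p a. prime p \<Longrightarrow> P (p ^ Suc a)"
    and mult: "\<And>m n. \<lbrakk>m > 1; n > 1; coprime m n; P m; P n\<rbrakk> \<Longrightarrow> P (m * n)"
  shows "P n"
  using assms(1)
proof (induction n rule: less_induct)
  case (less n)
  show ?case
  proof (cases "n = 1")
    case False
    then obtain p where p: "prime p" "p dvd n"
      using prime_factor_nat by blast
    then obtain a m where n: "n = p ^ Suc a * m" and "m > 0" "coprime (p ^ Suc a) m"
      using less.prems by (elim prime_power_cofactorE)
    have "p ^ Suc a > 1"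
      using prime_gt_1_nat[OF p(1)] by (intro one_less_power) simp_all
    show ?thesis
    proof (cases "m = 1")
      case True
      thus ?thesis
        using prime_power[OF p(1)] by (simp add: n)
    next
      case False
      hence "m > 1"
        using \<open>m > 0\<close> by simp
      moreover have "P m"
        using \<open>m > 0\<close> \<open>p ^ Suc a > 1\<close> by (intro less.IH) (simp_all add: n del: power_Suc)
      ultimately show ?thesis
        unfolding n using \<open>p ^ Suc a > 1\<close> \<open>coprime (p ^ Suc a) m\<close> prime_power[OF p(1)]
        by (intro mult)
    qed
  qed (use one in simp)
qed

lemma bij_betw_residues_mult_coprime:
  assumes "coprime m n" "m > 0" "n > (0 :: nat)"
  shows "bij_betw (\<lambda>(i, j). (i * n + j * m) mod (m * n)) ({..<m} \<times> {..<n}) {..<m * n}"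
proof -
  let ?f = "\<lambda>(i, j). (i * n + j * m) mod (m * n)"
  have inj: "inj_on ?f ({..<m} \<times> {..<n})"
  proof (rule inj_onI, clarsimp)
    fix i j i' j' assume bounds: "i < m" "j < n" "i' < m" "j' < n"
      and "(i * n + j * m) mod (m * n) = (i' * n + j' * m) mod (m * n)"
    hence cong: "[i * n + j * m = i' * n + j' * m] (mod m * n)"
      by (simp add: cong_def)
    have "[i * n = i' * n] (mod m)"
      using cong_modulus_mult_nat[OF cong] by (simp add: cong_def)
    moreover have "[j * m = j' * m] (mod n)"
      using cong_modulus_mult_nat[OF cong[unfolded mult.commute[of m n]]] by (simp add: cong_def)
    ultimately have "[i = i'] (mod m)" "[j = j'] (mod n)"
      using assms by (simp_all add: cong_mult_rcancel_nat coprime_commute)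
    thus "i = i' \<and> j = j'"
      using bounds by (simp add: cong_def)
  qed
  have "?f ` ({..<m} \<times> {..<n}) = {..<m * n}"
    by (rule card_subset_eq) (use assms in \<open>auto simp: card_image[OF inj] card_cartesian_product\<close>)
  with inj show ?thesis
    by (simp add: bij_betw_def)
qed

lemma sum_multiples:
  assumes "d > (0 :: nat)"
  shows "(\<Sum>k<d * e. if d dvd k then f k else 0) = (\<Sum>i<e. f (d * i))"
proof -
  have "(\<Sum>k<d * e. if d dvd k then f k else 0) = (\<Sum>k | k < d * e \<and> d dvd k. f k)"
    by (subst sum.inter_filter[symmetric]) auto
  also have "\<dots> = (\<Sum>i<e. f (d * i))"
    by (rule sum.reindex_bij_witness[of _ "\<lambda>i. d * i" "\<lambda>k. k div d"]) (use assms in auto)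
  finally show ?thesis .
qed

lemma sum_alternating_odd_symmetric:
  fixes f :: "nat \<Rightarrow> 'a :: {idom, ring_char_0}"
  assumes "odd n" and "\<And>k. 0 < k \<Longrightarrow> k < n \<Longrightarrow> f (n - k) = f k"
  shows "(\<Sum>k<n. f k * (-1) ^ k) = f 0"
proof -
  have "(\<Sum>k\<in>{1..<n}. f k * (-1) ^ k) = (\<Sum>k\<in>{1..<n}. f (n - k) * (-1) ^ (n - k))"
    by (rule sum.reindex_bij_witness[of _ "\<lambda>k. n - k" "\<lambda>k. n - k"]) auto
  also have "\<dots> = (\<Sum>k\<in>{1..<n}. - (f k * (-1) ^ k))"
    using assms by (intro sum.cong refl) (auto simp: minus_one_power_iff)
  also have "\<dots> = - (\<Sum>k\<in>{1..<n}. f k * (-1) ^ k)"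
    by (rule sum_negf)
  finally have "(\<Sum>k\<in>{1..<n}. f k * (-1) ^ k) = 0"
    by (simp add: eq_neg_iff_add_eq_0 flip: mult_2)
  moreover have "{..<n} = insert 0 {1..<n}"
    using odd_pos[OF assms(1)] by auto
  ultimately show ?thesis
    by simp
qed

subsection \<open>Roots of unity\<close>

lemma power_mod_root_of_unity:
  assumes "(z :: 'a :: monoid_mult) ^ n = 1"
  shows "z ^ (k mod n) = z ^ k"
proof -
  have "z ^ k = (z ^ n) ^ (k div n) * z ^ (k mod n)"
    by (metis mult_div_mod_eq power_add power_mult)
  thus ?thesis
    using assms by simp
qed

lemma sum_powers_root_of_unity:
  assumes "(w :: 'a :: field) ^ n = 1"
  shows "(\<Sum>i<n. w ^ i) = (if w = 1 then of_nat n else 0)"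
  using assms geometric_sum[of w n] by auto

definition unity_root :: "nat \<Rightarrow> int \<Rightarrow> complex" where
  "unity_root n k = cis (2 * pi * of_int k / of_nat n)"

lemma unity_root_0 [simp]: "unity_root n 0 = 1"
  by (simp add: unity_root_def)

lemma unity_root_add: "unity_root n (j + k) = unity_root n j * unity_root n k"
  by (simp add: unity_root_def cis_mult add_divide_distrib ring_distribs)

lemma unity_root_of_nat_mult: "unity_root n (int j * k) = unity_root n k ^ j"
  by (simp add: unity_root_def Complex.DeMoivre mult_ac)

lemma unity_root_uminus: "unity_root n (- k) = cnj (unity_root n k)"
  by (simp add: unity_root_def cis_cnj)

lemma unity_root_mult_cancel:
  assumes "m > 0"
  shows "unity_root (m * n) (int m * k) = unity_root n k"
  using assms by (simp add: unity_root_def mult_ac)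

lemma unity_root_eq_1_iff:
  assumes "n > 0"
  shows "unity_root n k = 1 \<longleftrightarrow> int n dvd k"
proof -
  have "unity_root n k = 1 \<longleftrightarrow> (\<exists>q. real_of_int k = real_of_int (int n * q))"
    unfolding unity_root_def cis_eq_1_iff using assms by (simp add: field_simps)
  thus ?thesis
    unfolding of_int_eq_iff dvd_def .
qed

lemma unity_root_cong:
  assumes "n > 0" "[j = k] (mod int n)"
  shows "unity_root n j = unity_root n k"
proof -
  have "unity_root n (j - k) = 1"
    using assms by (simp add: unity_root_eq_1_iff cong_iff_dvd_diff)
  thus ?thesis
    using unity_root_add[of n "j - k" k] by simp
qed

lemma sum_unity_root:
  assumes "n > 0"
  shows "(\<Sum>j\<in>{0<..n}. unity_root n (int j * k)) = (if int n dvd k then of_nat n else 0)"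
proof -
  have "unity_root n k ^ n = 1"
    using assms by (simp add: unity_root_eq_1_iff flip: unity_root_of_nat_mult)
  moreover have "(\<Sum>j\<in>{0<..n}. unity_root n (int j * k)) =
      unity_root n k * (\<Sum>j<n. unity_root n k ^ j)"
    unfolding unity_root_of_nat_mult
    by (simp add: sum.atLeast1_atMost_eq sum_distrib_left flip: atLeastSucAtMost_greaterThanAtMost)
  ultimately show ?thesis
    using assms by (simp add: sum_powers_root_of_unity unity_root_eq_1_iff)
qed

subsection \<open>Ramanujan sums\<close>

lemma ramanujan_sum_eq_sum_totatives:
  "ramanujan_sum n k = (\<Sum>j\<in>totatives n. unity_root n (int j * k))"
proof -
  have "{j\<in>{1..n}. gcd j n = 1} = totatives n"
    by (auto simp: totatives_def coprime_iff_gcd_eq_1)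
  moreover have "exp (2 * of_real pi * \<i> * of_nat j * of_int k / of_nat n) =
      unity_root n (int j * k)" for j
    by (simp add: unity_root_def cis_conv_exp mult_ac)
  ultimately show ?thesis
    unfolding ramanujan_sum_def by simp
qed

lemma ramanujan_sum_0: "ramanujan_sum n 0 = of_nat (totient n)"
  by (simp add: ramanujan_sum_eq_sum_totatives totient_def)

lemma ramanujan_sum_Suc_0 [simp]: "ramanujan_sum (Suc 0) k = 1"
  by (simp add: ramanujan_sum_eq_sum_totatives unity_root_eq_1_iff)

lemma ramanujan_sum_cong:
  assumes "n > 0" "[k = l] (mod int n)"
  shows "ramanujan_sum n k = ramanujan_sum n l"
  unfolding ramanujan_sum_eq_sum_totatives
  by (intro sum.cong refl unity_root_cong cong_scalar_left assms)

lemma cmod_ramanujan_sum_uminus: "cmod (ramanujan_sum n (- k)) = cmod (ramanujan_sum n k)"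
proof -
  have "ramanujan_sum n (- k) = cnj (ramanujan_sum n k)"
    by (simp add: ramanujan_sum_eq_sum_totatives unity_root_uminus)
  thus ?thesis
    by simp
qed

lemma ramanujan_sum_mult_coprime:
  assumes "m > 1" "n > 1" "coprime m n"
  shows "ramanujan_sum (m * n) (i * int n + j * int m) = ramanujan_sum m i * ramanujan_sum n j"
proof -
  have split: "unity_root (m * n) (int l * (i * int n + j * int m)) =
      unity_root m (int (l mod m) * i) * unity_root n (int (l mod n) * j)" for l
  proof -
    have "int l * (i * int n + j * int m) = int n * (int l * i) + int m * (int l * j)"
      by (simp add: algebra_simps)
    hence "unity_root (m * n) (int l * (i * int n + j * int m)) =
        unity_root m (int l * i) * unity_root n (int l * j)"
      using assms unity_root_mult_cancel[of n m "int l * i"]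
        unity_root_mult_cancel[of m n "int l * j"]
      by (simp add: unity_root_add mult.commute[of n m])
    also have "unity_root m (int l * i) = unity_root m (int (l mod m) * i)"
      using assms by (intro unity_root_cong cong_scalar_right) (simp_all add: cong_def zmod_int)
    also have "unity_root n (int l * j) = unity_root n (int (l mod n) * j)"
      using assms by (intro unity_root_cong cong_scalar_right) (simp_all add: cong_def zmod_int)
    finally show ?thesis .
  qed
  have "ramanujan_sum (m * n) (i * int n + j * int m) =
      (\<Sum>(a, b)\<in>totatives m \<times> totatives n. unity_root m (int a * i) * unity_root n (int b * j))"
    unfolding ramanujan_sum_eq_sum_totatives split
    using sum.reindex_bij_betw[OF bij_betw_totatives[OF assms],
        of "\<lambda>(a, b). unity_root m (int a * i) * unity_root n (int b * j)"] by simp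
  thus ?thesis
    by (simp add: ramanujan_sum_eq_sum_totatives sum_product sum.cartesian_product)
qed

lemma ramanujan_sum_prime_power:
  assumes "prime p"
  shows "ramanujan_sum (p ^ Suc a) k =
    of_int ((if int (p ^ Suc a) dvd k then int (p ^ Suc a) else 0) -
      (if int (p ^ a) dvd k then int (p ^ a) else 0))"
proof -
  have pos: "p > 0" "p ^ a > 0" "p ^ Suc a > 0"
    using prime_gt_0_nat[OF assms] by simp_all
  let ?e = "\<lambda>j. unity_root (p ^ Suc a) (int j * k)"
  have "(\<Sum>j\<in>(\<lambda>j. p * j) ` {0<..p ^ a}. ?e j) = (\<Sum>j\<in>{0<..p ^ a}. unity_root (p ^ a) (int j * k))"
    using pos(1) unity_root_mult_cancel[OF pos(1), of "p ^ a"]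
    by (subst sum.reindex) (auto simp: inj_on_def mult.assoc)
  moreover have "ramanujan_sum (p ^ Suc a) k =
      (\<Sum>j\<in>{0<..p ^ Suc a}. ?e j) - (\<Sum>j\<in>(\<lambda>j. p * j) ` {0<..p ^ a}. ?e j)"
    unfolding ramanujan_sum_eq_sum_totatives totatives_prime_power_Suc[OF assms]
    using pos(1) by (intro sum_diff) auto
  ultimately show ?thesis
    unfolding sum_unity_root[OF pos(2)] sum_unity_root[OF pos(3)] by simp
qed

text \<open>Of the values \<open>p\<^sup>a\<^sup>+\<^sup>1 - p\<^sup>a\<close>, \<open>-p\<^sup>a\<close> and \<open>0\<close> only the second changes its sign, so the absolute
  value is still a combination of two divisibility indicators.\<close>

lemma cmod_ramanujan_sum_prime_power:
  assumes "prime p"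
  shows "cmod (ramanujan_sum (p ^ Suc a) (int k)) =
    (if p ^ a dvd k then real (p ^ a) else 0) +
    (if p ^ Suc a dvd k then real (p ^ Suc a) - 2 * real (p ^ a) else 0)"
proof -
  have "int (p ^ a) \<le> int (p ^ Suc a)"
    using prime_gt_0_nat[OF assms] by simp
  hence "\<bar>int (p ^ Suc a) - int (p ^ a)\<bar> = int (p ^ Suc a) - int (p ^ a)"
    by (simp only: abs_of_nonneg diff_ge_0_iff_ge)
  moreover have "p ^ a dvd k" if "p ^ Suc a dvd k"
    using that by (metis dvd_mult_right power_Suc)
  ultimately show ?thesis
    unfolding ramanujan_sum_prime_power[OF assms] norm_of_int int_dvd_int_iff
    by (auto simp del: power_Suc of_nat_power)
qed

lemma ramanujan_sum_Ints:
  assumes "n > 0"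
  shows "ramanujan_sum n k \<in> \<int>"
  using assms
proof (induction n arbitrary: k rule: coprime_factor_induct)
  case one
  show ?case
    by simp
next
  case (prime_power p a)
  show ?case
    unfolding ramanujan_sum_prime_power[OF prime_power] by (rule Ints_of_int)
next
  case (mult m n)
  obtain u v where "u * int m + v * int n = 1"
    using bezout_int[of "int m" "int n"] mult.hyps(3) by auto
  hence k: "k * v * int n + k * u * int m = k"
    by (metis add.commute distrib_left mult.assoc mult.right_neutral)
  have "ramanujan_sum (m * n) k = ramanujan_sum m (k * v) * ramanujan_sum n (k * u)"
    using ramanujan_sum_mult_coprime[OF mult.hyps(1-3), of "k * v" "k * u"] unfolding k .
  thus ?case
    using mult.IH by simp
qed

subsection \<open>Values at roots of unity\<close>

lemma poly_abs_ramanujan_poly: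
  "poly (abs_ramanujan_poly n) z = (\<Sum>k<n. of_real (cmod (ramanujan_sum n (int k))) * z ^ k)"
  by (simp add: abs_ramanujan_poly_def poly_sum poly_monom)

lemma poly_abs_ramanujan_poly_mult_coprime:
  assumes "m > 1" "n > 1" "coprime m n" "z ^ (m * n) = 1"
  shows "poly (abs_ramanujan_poly (m * n)) z =
    poly (abs_ramanujan_poly m) (z ^ n) * poly (abs_ramanujan_poly n) (z ^ m)"
proof -
  let ?t = "\<lambda>n z k. complex_of_real (cmod (ramanujan_sum n (int k))) * z ^ k"
  have split: "?t (m * n) z ((i * n + j * m) mod (m * n)) = ?t m (z ^ n) i * ?t n (z ^ m) j" for i j
  proof -
    have "ramanujan_sum (m * n) (int ((i * n + j * m) mod (m * n))) =
        ramanujan_sum (m * n) (int i * int n + int j * int m)"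
      using assms by (intro ramanujan_sum_cong) (simp_all add: cong_def zmod_int)
    hence "ramanujan_sum (m * n) (int ((i * n + j * m) mod (m * n))) =
        ramanujan_sum m (int i) * ramanujan_sum n (int j)"
      unfolding ramanujan_sum_mult_coprime[OF assms(1-3)] .
    moreover have "z ^ ((i * n + j * m) mod (m * n)) = (z ^ n) ^ i * (z ^ m) ^ j"
      unfolding power_mod_root_of_unity[OF assms(4)]
      by (simp add: power_add mult.commute flip: power_mult)
    ultimately show ?thesis
      by (simp add: norm_mult)
  qed
  have "poly (abs_ramanujan_poly (m * n)) z =
      (\<Sum>(i, j)\<in>{..<m} \<times> {..<n}. ?t m (z ^ n) i * ?t n (z ^ m) j)"
    unfolding poly_abs_ramanujan_poly split[symmetric]
    using assms sum.reindex_bij_betw[OF bij_betw_residues_mult_coprime, of m n "?t (m * n) z"]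
    by (simp add: case_prod_unfold)
  thus ?thesis
    by (simp add: poly_abs_ramanujan_poly sum_product sum.cartesian_product)
qed

definition local_factor :: "nat \<Rightarrow> complex \<Rightarrow> nat \<Rightarrow> complex" where
  "local_factor n z p = (if z ^ (n div p) = 1 then 2 * (1 - 1 / of_nat p) else 1 - 2 / of_nat p)"

lemma local_factor_mult:
  assumes "p dvd n"
  shows "local_factor (m * n) z p = local_factor n (z ^ m) p"
  by (simp add: local_factor_def assms power_mult flip: div_mult_swap)

lemma prod_local_factor_mult_coprime:
  assumes "coprime m n" "m > 0" "n > 0"
  shows "(\<Prod>p\<in>prime_factors (m * n). local_factor (m * n) z p) =
    (\<Prod>p\<in>prime_factors m. local_factor m (z ^ n) p) * (\<Prod>p\<in>prime_factors n. local_factor n (z ^ m) p)"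
proof -
  have "prime_factors m \<inter> prime_factors n = {}"
    using assms(1) by (auto dest: coprime_common_divisor not_prime_unit)
  hence "(\<Prod>p\<in>prime_factors (m * n). local_factor (m * n) z p) =
      (\<Prod>p\<in>prime_factors m. local_factor (m * n) z p) *
      (\<Prod>p\<in>prime_factors n. local_factor (m * n) z p)"
    using assms by (simp add: prime_factors_product prod.union_disjoint)
  also have "(\<Prod>p\<in>prime_factors m. local_factor (m * n) z p) =
      (\<Prod>p\<in>prime_factors m. local_factor m (z ^ n) p)"
    by (intro prod.cong refl) (auto simp: mult.commute[of m n] local_factor_mult)
  also have "(\<Prod>p\<in>prime_factors n. local_factor (m * n) z p) =
      (\<Prod>p\<in>prime_factors n. local_factor n (z ^ m) p)"
    by (intro prod.cong refl) (auto simp: local_factor_mult)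
  finally show ?thesis .
qed

lemma poly_abs_ramanujan_poly_prime_power:
  assumes "prime p"
  shows "poly (abs_ramanujan_poly (p ^ Suc a)) z =
    of_nat (p ^ a) * (\<Sum>i<p. (z ^ (p ^ a)) ^ i) + (of_nat (p ^ Suc a) - 2 * of_nat (p ^ a))"
proof -
  have pos: "p ^ a > 0" "p ^ Suc a > 0"
    using prime_gt_0_nat[OF assms] by simp_all
  have "poly (abs_ramanujan_poly (p ^ Suc a)) z =
      (\<Sum>k<p ^ a * p. if p ^ a dvd k then of_nat (p ^ a) * z ^ k else 0) +
      (\<Sum>k<p ^ Suc a * 1. if p ^ Suc a dvd k
        then (of_nat (p ^ Suc a) - 2 * of_nat (p ^ a)) * z ^ k else 0)"
    unfolding poly_abs_ramanujan_poly cmod_ramanujan_sum_prime_power[OF assms]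
      power_Suc2[symmetric] mult_1_right sum.distrib[symmetric]
    by (intro sum.cong refl) (simp add: algebra_simps del: power_Suc of_nat_power)
  thus ?thesis
    unfolding sum_multiples[OF pos(1)] sum_multiples[OF pos(2)]
    by (simp add: power_mult flip: sum_distrib_left)
qed

lemma poly_abs_ramanujan_poly_root_of_unity:
  assumes "n > 0" "z ^ n = 1"
  shows "poly (abs_ramanujan_poly n) z = of_nat n * (\<Prod>p\<in>prime_factors n. local_factor n z p)"
  using assms
proof (induction n arbitrary: z rule: coprime_factor_induct)
  case one
  show ?case
    by (simp add: poly_abs_ramanujan_poly)
next
  case (prime_power p a)
  have "(z ^ (p ^ a)) ^ p = 1"
    using prime_power.prems by (simp add: mult.commute flip: power_mult)
  moreover have "p > 0"
    using prime_gt_0_nat[OF prime_power.hyps] .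
  moreover have "prime_factors (p ^ Suc a) = {p}"
    using prime_power.hyps by (simp add: prime_factors_power prime_prime_factors del: power_Suc)
  ultimately show ?case
    unfolding poly_abs_ramanujan_poly_prime_power[OF prime_power.hyps]
    by (simp add: sum_powers_root_of_unity local_factor_def field_simps)
next
  case (mult m n)
  have "(z ^ n) ^ m = 1" "(z ^ m) ^ n = 1"
    using mult.prems by (simp_all add: mult.commute flip: power_mult)
  thus ?case
    using mult by (simp add: poly_abs_ramanujan_poly_mult_coprime prod_local_factor_mult_coprime)
qed

lemma poly_abs_ramanujan_poly_primitive_root:
  assumes "primitive_root_of_unity n \<eta>"
  shows "poly (abs_ramanujan_poly n) \<eta> = of_nat n * (\<Prod>p\<in>prime_factors n. 1 - 2 / of_nat p)"
proof -
  have n: "n > 0" "\<eta> ^ n = 1"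
    using assms by (simp_all add: primitive_root_of_unity_def)
  have "local_factor n \<eta> p = 1 - 2 / of_nat p" if "p \<in> prime_factors n" for p
  proof -
    have "prime p" "p dvd n"
      using that by auto
    hence "0 < n div p" "n div p < n"
      using n(1) prime_gt_1_nat by (auto simp: div_greater_zero_iff dvd_imp_le prime_gt_0_nat)
    thus ?thesis
      using assms by (simp add: local_factor_def primitive_root_of_unity_def)
  qed
  thus ?thesis
    using poly_abs_ramanujan_poly_root_of_unity[OF n] by simp
qed

lemma poly_abs_ramanujan_poly_minus_one_odd:
  assumes "odd n"
  shows "poly (abs_ramanujan_poly n) (-1) = of_nat (totient n)"
proof -
  have "cmod (ramanujan_sum n (int (n - k))) = cmod (ramanujan_sum n (int k))" if "k < n" for k
  proof -
    have "ramanujan_sum n (int (n - k)) = ramanujan_sum n (- int k)"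
      using that by (intro ramanujan_sum_cong) (simp_all add: of_nat_diff cong_iff_dvd_diff)
    thus ?thesis
      by (simp add: cmod_ramanujan_sum_uminus)
  qed
  thus ?thesis
    unfolding poly_abs_ramanujan_poly
    by (subst sum_alternating_odd_symmetric[OF assms]) (simp_all add: ramanujan_sum_0)
qed

lemma poly_abs_ramanujan_poly_minus_one_twice_odd:
  assumes "even n" "odd (n div 2)"
  shows "poly (abs_ramanujan_poly n) (-1) = 0"
proof -
  have "n > 0"
    using assms(2) by (auto intro: Nat.gr0I)
  hence "2 \<in> prime_factors n" "local_factor n (-1) 2 = 0"
    using assms by (auto simp: prime_factors_dvd local_factor_def)
  hence "(\<Prod>p\<in>prime_factors n. local_factor n (-1) p) = 0"
    by (auto simp: prod_zero_iff)
  thus ?thesis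
    using poly_abs_ramanujan_poly_root_of_unity[of n "-1"] \<open>n > 0\<close> assms(1) by simp
qed

lemma poly_abs_ramanujan_poly_minus_one_4_dvd:
  assumes "4 dvd n" "n > 0"
  shows "poly (abs_ramanujan_poly n) (-1) = of_nat (totient n * 2 ^ num_prime_factors n)"
proof -
  have "even (n div p)" if p: "prime p" "p dvd n" for p
  proof (cases "p = 2")
    case False
    have "even (p * (n div p))"
      using assms(1) p(2) by auto
    thus ?thesis
      using False p(1) primes_dvd_imp_eq[OF two_is_prime_nat p(1)] by auto
  qed (use assms(1) in auto)
  hence "(\<Prod>p\<in>prime_factors n. local_factor n (-1) p) =
      (\<Prod>p\<in>prime_factors n. 2 * (1 - 1 / of_nat p))"
    by (intro prod.cong refl) (simp add: local_factor_def in_prime_factors_iff uminus_power_if)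
  also have "\<dots> = 2 ^ num_prime_factors n * (\<Prod>p\<in>prime_factors n. 1 - 1 / of_nat p)"
    unfolding prod.distrib by (simp add: num_prime_factors_def)
  finally have "poly (abs_ramanujan_poly n) (-1) =
      2 ^ num_prime_factors n * (of_nat n * (\<Prod>p\<in>prime_factors n. 1 - 1 / of_nat p))"
    using poly_abs_ramanujan_poly_root_of_unity[of n "-1"] assms by auto
  also have "of_nat n * (\<Prod>p\<in>prime_factors n. 1 - 1 / of_nat p) = complex_of_nat (totient n)"
    using arg_cong[OF totient_formula2[of n], of complex_of_real] by simp
  finally show ?thesis
    by simp
qed

subsection \<open>Monic integer polynomials\<close>

abbreviation of_int_poly :: "int poly \<Rightarrow> 'a :: ring_1 poly" where
  "of_int_poly \<equiv> map_poly of_int"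

lemma of_int_poly_diff: "of_int_poly (p - q) = of_int_poly p - of_int_poly q"
  by (rule poly_eqI) (simp add: coeff_map_poly)

lemma of_int_poly_mult: "of_int_poly (p * q) = of_int_poly p * of_int_poly q"
  by (rule poly_eqI) (simp add: coeff_map_poly coeff_mult)

lemma of_int_poly_eq_0_iff: "(of_int_poly p :: 'a :: ring_char_0 poly) = 0 \<longleftrightarrow> p = 0"
  by (rule map_poly_eq_0_iff) simp_all

lemma degree_of_int_poly: "degree (of_int_poly p :: 'a :: ring_char_0 poly) = degree p"
  by (rule degree_map_poly) simp

lemma of_int_poly_if_coeffs_Ints:
  fixes P :: "'a :: ring_char_0 poly"
  assumes "\<And>i. coeff P i \<in> \<int>"
  shows "\<exists>p. P = of_int_poly p"
proof -
  have "\<forall>i. \<exists>c. coeff P i = of_int c"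
    using assms by (auto elim: Ints_cases)
  then obtain c where c: "\<And>i. coeff P i = of_int (c i)"
    by metis
  hence "MOST i. c i = 0"
    using MOST_coeff_eq_0[of P] by simp
  hence "coeff (Abs_poly c) = c"
    by (simp add: Abs_poly_inverse)
  thus ?thesis
    using c by (intro exI[of _ "Abs_poly c"] poly_eqI) (simp add: coeff_map_poly)
qed

lemma of_int_poly_dvd_iff:
  assumes "lead_coeff f = 1"
  shows "(of_int_poly f :: 'a :: {idom, ring_char_0} poly) dvd of_int_poly p \<longleftrightarrow> f dvd p"
proof
  assume dvd: "(of_int_poly f :: 'a poly) dvd of_int_poly p"
  obtain q r where qr: "pseudo_divmod p f = (q, r)"
    by fastforce
  have "f \<noteq> 0"
    using assms by auto
  note division = pseudo_divmod[OF this qr, unfolded assms power_one smult_1_left]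
  have "r = p - f * q"
    using division(1) by simp
  hence "(of_int_poly f :: 'a poly) dvd of_int_poly r"
    using dvd by (simp add: of_int_poly_diff of_int_poly_mult)
  hence "degree f \<le> degree r" if "r \<noteq> 0"
    using dvd_imp_degree_le[of "of_int_poly f :: 'a poly" "of_int_poly r"] that
    by (simp add: degree_of_int_poly of_int_poly_eq_0_iff)
  hence "r = 0"
    using division(2) by fastforce
  thus "f dvd p"
    using division(1) by simp
qed (auto simp: of_int_poly_mult elim!: dvdE)

definition monic_integral :: "'a :: {idom, ring_char_0} poly \<Rightarrow> bool" where
  "monic_integral P \<longleftrightarrow> (\<exists>f. P = of_int_poly f \<and> lead_coeff f = 1)"

lemma monic_integral_mult:
  assumes "monic_integral P" "monic_integral Q"
  shows "monic_integral (P * Q)"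
  using assms unfolding monic_integral_def by (metis lead_coeff_mult mult_1 of_int_poly_mult)

lemma monic_integral_prod:
  assumes "\<And>x. x \<in> A \<Longrightarrow> monic_integral (F x)"
  shows "monic_integral (\<Prod>x\<in>A. F x)"
proof -
  have "monic_integral (1 :: 'b :: {idom, ring_char_0} poly)"
    unfolding monic_integral_def by (intro exI[of _ 1]) simp
  thus ?thesis
    using assms by (induction A rule: infinite_finite_induct) (auto intro: monic_integral_mult)
qed

lemma monic_integral_cofactor:
  assumes "monic_integral P" "monic_integral (P * Q)"
  shows "monic_integral Q"
proof -
  obtain f g where f: "P = of_int_poly f" "lead_coeff f = 1"
    and g: "P * Q = of_int_poly g" "lead_coeff g = 1"
    using assms unfolding monic_integral_def by blast
  have "P dvd of_int_poly g"
    unfolding g(1)[symmetric] by (rule dvd_triv_left)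
  hence "f dvd g"
    unfolding f(1) of_int_poly_dvd_iff[OF f(2)] .
  then obtain q where q: "g = f * q" ..
  have "P \<noteq> 0"
    using f by (auto simp: of_int_poly_eq_0_iff)
  hence "Q = of_int_poly q"
    using g(1) unfolding q of_int_poly_mult f(1) by simp
  moreover have "lead_coeff q = 1"
    using f(2) g(2) unfolding q lead_coeff_mult by simp
  ultimately show ?thesis
    unfolding monic_integral_def by blast
qed

subsection \<open>Cyclotomic polynomials\<close>

lemma finite_primitive_roots: "finite {z. primitive_root_of_unity n z}"
proof (cases "n = 0")
  case False
  thus ?thesis
    by (intro finite_subset[OF _ finite_roots_unity[of n]]) (auto simp: primitive_root_of_unity_def)
qed (simp add: primitive_root_of_unity_def)

lemma primitive_root_of_unity_pow_eq_1_iff: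
  assumes "primitive_root_of_unity n z"
  shows "z ^ m = 1 \<longleftrightarrow> n dvd m"
proof
  have n: "n > 0" "z ^ n = 1" and minimal: "\<And>k. 0 < k \<Longrightarrow> k < n \<Longrightarrow> z ^ k \<noteq> 1"
    using assms by (auto simp: primitive_root_of_unity_def)
  show "n dvd m" if "z ^ m = 1"
  proof -
    have "z ^ (m mod n) = 1"
      using that by (simp add: power_mod_root_of_unity n)
    thus ?thesis
      using minimal[of "m mod n"] n(1) by auto
  qed
  show "z ^ m = 1" if "n dvd m"
    using that n by (auto simp: power_mult elim!: dvdE)
qed

lemma primitive_root_of_unity_unique:
  assumes "primitive_root_of_unity m z" "primitive_root_of_unity n z"
  shows "m = n"
  using assms[THEN primitive_root_of_unity_pow_eq_1_iff] by (metis dvd_antisym dvd_refl)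

lemma ex_primitive_root_of_unity:
  assumes "n > 0" "(z :: complex) ^ n = 1"
  shows "\<exists>d. d dvd n \<and> primitive_root_of_unity d z"
proof -
  define d where "d = (LEAST d. d > 0 \<and> z ^ d = 1)"
  have "d > 0 \<and> z ^ d = 1"
    unfolding d_def by (rule LeastI[of _ n]) (use assms in auto)
  hence "primitive_root_of_unity d z"
    unfolding primitive_root_of_unity_def d_def by (blast dest: not_less_Least)
  thus ?thesis
    using primitive_root_of_unity_pow_eq_1_iff assms by blast
qed

lemma lead_coeff_monom_minus_one:
  assumes "n > 0"
  shows "lead_coeff (monom 1 n - 1 :: 'a :: comm_ring_1 poly) = 1"
proof -
  have "degree (monom 1 n - 1 :: 'a poly) = n"
    using assms degree_add_eq_left[of "-1" "monom 1 n :: 'a poly"] by (simp add: degree_monom_eq)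
  thus ?thesis
    using assms by simp
qed

lemma prod_roots_of_unity:
  assumes "n > 0"
  shows "(\<Prod>z | z ^ n = 1. [:- z, 1:]) = monom 1 n - (1 :: complex poly)"
proof -
  let ?p = "monom 1 n - (1 :: complex poly)"
  have "poly ?p z = 0 \<longleftrightarrow> z ^ n = 1" for z
    by (simp add: poly_monom)
  moreover have "rsquarefree ?p"
    unfolding rsquarefree_roots
    using assms by (auto simp: pderiv_diff pderiv_monom poly_monom zero_power)
  ultimately show ?thesis
    using complex_poly_decompose_rsquarefree[of ?p]
      lead_coeff_monom_minus_one[OF assms, where ?'a = complex]
    by simp
qed

lemma prod_cyclotomic_poly:
  assumes "n > 0"
  shows "(\<Prod>d | d dvd n. cyclotomic_poly d) = monom 1 n - 1"
proof -
  have "{z :: complex. z ^ n = 1} = (\<Union>d\<in>{d. d dvd n}. {z. primitive_root_of_unity d z})"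
    using ex_primitive_root_of_unity[OF assms] by (auto simp: primitive_root_of_unity_pow_eq_1_iff)
  moreover have "(\<Prod>z\<in>(\<Union>d\<in>{d. d dvd n}. {z. primitive_root_of_unity d z}). [:- z, 1:]) =
      (\<Prod>d | d dvd n. cyclotomic_poly d)"
    unfolding cyclotomic_poly_def
    using assms by (intro prod.UNION_disjoint)
      (auto simp: finite_primitive_roots dest: primitive_root_of_unity_unique)
  ultimately show ?thesis
    using prod_roots_of_unity[OF assms] by simp
qed

lemma monic_integral_cyclotomic_poly:
  assumes "n > 0"
  shows "monic_integral (cyclotomic_poly n)"
  using assms
proof (induction n rule: less_induct)
  case (less n)
  let ?D = "{d. d dvd n} - {n}"
  have "monic_integral (\<Prod>d\<in>?D. cyclotomic_poly d)"
    using less.prems by (intro monic_integral_prod less.IH) (auto dest: dvd_imp_le intro: Nat.gr0I)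
  moreover have "(\<Prod>d\<in>?D. cyclotomic_poly d) * cyclotomic_poly n = of_int_poly (monom 1 n - 1)"
    using less.prems prod.remove[of "{d. d dvd n}" n cyclotomic_poly]
    by (simp add: prod_cyclotomic_poly of_int_poly_diff map_poly_monom mult.commute)
  moreover have "lead_coeff (monom 1 n - 1 :: int poly) = 1"
    by (rule lead_coeff_monom_minus_one[OF less.prems])
  ultimately show ?case
    using monic_integral_cofactor monic_integral_def by metis
qed

lemma prod_linear_factors_dvd:
  fixes p :: "'a :: idom poly"
  assumes "finite S" "\<And>z. z \<in> S \<Longrightarrow> poly p z = 0"
  shows "(\<Prod>z\<in>S. [:- z, 1:]) dvd p"
  using assms
proof (induction S arbitrary: p rule: finite_induct)
  case (insert a S)
  from insert.prems obtain q where q: "p = [:- a, 1:] * q"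
    by (meson dvdE insertI1 poly_eq_0_iff_dvd)
  have "poly q z = 0" if "z \<in> S" for z
    using insert.prems[of z] insert.hyps that unfolding q by auto
  hence "(\<Prod>z\<in>S. [:- z, 1:]) dvd q"
    by (rule insert.IH)
  thus ?case
    unfolding q prod.insert[OF insert.hyps] by (rule mult_dvd_mono[OF dvd_refl])
qed simp

lemma abs_ramanujan_poly_integral:
  assumes "n > 0"
  shows "\<exists>p. abs_ramanujan_poly n = of_int_poly p"
proof (rule of_int_poly_if_coeffs_Ints)
  have "complex_of_real (cmod (ramanujan_sum n k)) \<in> \<int>" for k
  proof -
    obtain a where "ramanujan_sum n k = of_int a"
      using ramanujan_sum_Ints[OF assms] by (rule Ints_cases)
    thus ?thesis
      by simp
  qed
  thus "coeff (abs_ramanujan_poly n) i \<in> \<int>" for i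
    unfolding abs_ramanujan_poly_def coeff_sum by (intro Ints_sum) simp
qed

lemma cyclotomic_poly_dvd_abs_ramanujan_poly:
  assumes "n > 0" "even n"
  shows "int_poly_dvd (cyclotomic_poly n) (abs_ramanujan_poly n)"
proof -
  have "2 \<in> prime_factors n"
    using assms by (simp add: prime_factors_dvd)
  hence "(\<Prod>p\<in>prime_factors n. 1 - 2 / complex_of_nat p) = 0"
    by (intro prod_zero bexI[of _ 2]) simp_all
  hence "cyclotomic_poly n dvd abs_ramanujan_poly n"
    unfolding cyclotomic_poly_def
    by (intro prod_linear_factors_dvd)
       (simp_all add: finite_primitive_roots poly_abs_ramanujan_poly_primitive_root)
  thus ?thesis
    using monic_integral_cyclotomic_poly[OF assms(1)] abs_ramanujan_poly_integral[OF assms(1)]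
    unfolding int_poly_dvd_def monic_integral_def by (metis of_int_poly_dvd_iff)
qed

theorem theorem12:
  shows "(\<forall>n::nat. n \<ge> 1 \<and> odd n \<longrightarrow>
            poly (abs_ramanujan_poly n) (-1) = of_nat (totient n)) \<and>
         (\<forall>n k::nat. n = 4 * k + 2 \<longrightarrow>
            poly (abs_ramanujan_poly n) (-1) = 0) \<and>
         (\<forall>n k::nat. k \<ge> 1 \<and> n = 4 * k \<longrightarrow>
            poly (abs_ramanujan_poly n) (-1) = of_nat (totient n * 2 ^ num_prime_factors n)) \<and>
         (\<forall>n::nat. n \<ge> 1 \<longrightarrow> (\<forall>\<eta>::complex. primitive_root_of_unity n \<eta> \<longrightarrow>
            poly (abs_ramanujan_poly n) \<eta> =
              of_nat n * (\<Prod>p\<in>prime_factors n. (1 - 2 / of_nat p)))) \<and>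
         (\<forall>n::nat. n \<ge> 2 \<and> even n \<longrightarrow>
            int_poly_dvd (cyclotomic_poly n) (abs_ramanujan_poly n))"
proof (intro conjI allI impI)
  fix n :: nat assume "n \<ge> 1 \<and> odd n"
  thus "poly (abs_ramanujan_poly n) (-1) = of_nat (totient n)"
    by (simp add: poly_abs_ramanujan_poly_minus_one_odd)
next
  fix n k :: nat assume "n = 4 * k + 2"
  thus "poly (abs_ramanujan_poly n) (-1) = 0"
    by (intro poly_abs_ramanujan_poly_minus_one_twice_odd) simp_all
next
  fix n k :: nat assume "k \<ge> 1 \<and> n = 4 * k"
  thus "poly (abs_ramanujan_poly n) (-1) = of_nat (totient n * 2 ^ num_prime_factors n)"
    by (intro poly_abs_ramanujan_poly_minus_one_4_dvd) simp_all
next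
  fix n :: nat and \<eta> assume "primitive_root_of_unity n \<eta>"
  thus "poly (abs_ramanujan_poly n) \<eta> = of_nat n * (\<Prod>p\<in>prime_factors n. 1 - 2 / of_nat p)"
    by (rule poly_abs_ramanujan_poly_primitive_root)
next
  fix n :: nat assume "n \<ge> 2 \<and> even n"
  thus "int_poly_dvd (cyclotomic_poly n) (abs_ramanujan_poly n)"
    by (intro cyclotomic_poly_dvd_abs_ramanujan_poly) simp_all
qed

end
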